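(* Let $\mathfrak b$ be a finite-dimensional real vector space, $\lambda_1,\dots,\lambda_m\in\mathfrak b^*\setminus\{0\}$, and $H=(h_1,\dots,h_m)\in\mathfrak b^m$ with $\lambda_\ell(h_\ell)>0$ for all $\ell$. Set $\hat h_\ell=h_\ell/\lambda_\ell(h_\ell)$, and for $i<j$ and $\varepsilon,\delta\in\{\pm1\}$ set $$c_{ij}^{\varepsilon\delta}(H)=2\sqrt{-1}\bigl(\delta\lambda_j(h_i)\,h_j-\varepsilon\lambda_i(h_j)\,h_i\bigr)\in\mathfrak b\otimes_{\mathbb R}\mathbb C.$$ Let $\{i,j\}$, $i<j$, be an edge of $\Gamma_H$. Then $$c_{ij}^{\varepsilon\delta}(H)=0\iff\hat h_j=(\delta/\varepsilon)\,\hat h_i.$$ An interacting pair (edge) $\{i,j\}$ either has all four signed coefficients $c_{ij}^{\pm\pm}(H)$ nonzero, or exactly two of them vanish, namely an opposite pair indexed by some $(\varepsilon,\delta)$ and $(-\varepsilon,-\delta)$. If $\{i,j\}$ is not an edge of $\Gamma_H$, all four coefficients vanish.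
   Context: $\Gamma_H$ is the support graph on $\{1,\dots,m\}$: $\{i,j\}$ with $i<j$ is an edge iff $\lambda_j(h_i)\ne0$ or $\lambda_i(h_j)\neq0$. *)

theory Defs
  imports "HOL-Analysis.Analysis"
begin

text \<open>
  The complexification of a real vector space \<open>V\<close>, that is \<open>V \<otimes> \<complex>\<close> over the reals: the element
  \<open>Cplxn u v\<close> stands for \<open>u \<otimes> 1 + v \<otimes> \<i>\<close>.  The lemmas below show that this type, with the
  bilinear map \<open>tensor\<close>, has the universal property of the tensor product, and that \<open>cscale\<close> is
  the complex structure coming from the right-hand factor.
\<close>

datatype 'a complexification = Cplxn (re_part: 'a) (im_part: 'a)

instantiation complexification :: (real_vector) real_vector
begin

definition "0 = Cplxn 0 0"
definition "x + y = Cplxn (re_part x + re_part y) (im_part x + im_part y)"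
definition "x - y = Cplxn (re_part x - re_part y) (im_part x - im_part y)"
definition "- x = Cplxn (- re_part x) (- im_part x)"
definition "r *\<^sub>R x = Cplxn (r *\<^sub>R re_part x) (r *\<^sub>R im_part x)"

instance
  by standard
    (simp_all add: zero_complexification_def plus_complexification_def minus_complexification_def
      uminus_complexification_def scaleR_complexification_def algebra_simps)

end

definition cscale :: "complex \<Rightarrow> 'a::real_vector complexification \<Rightarrow> 'a complexification" where
  "cscale z x = Cplxn (Re z *\<^sub>R re_part x - Im z *\<^sub>R im_part x)
                      (Re z *\<^sub>R im_part x + Im z *\<^sub>R re_part x)"

definition tensor :: "'a::real_vector \<Rightarrow> complex \<Rightarrow> 'a complexification" where
  "tensor v z = Cplxn (Re z *\<^sub>R v) (Im z *\<^sub>R v)"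

lemmas complexification_simps =
  zero_complexification_def plus_complexification_def minus_complexification_def
  uminus_complexification_def scaleR_complexification_def cscale_def tensor_def

lemma vector_space_cscale:
  "vector_space (cscale :: complex \<Rightarrow> 'a::real_vector complexification \<Rightarrow> 'a complexification)"
  by standard (simp_all add: complexification_simps algebra_simps)

lemma cscale_of_real: "cscale (of_real r) x = r *\<^sub>R x"
  by (simp add: complexification_simps)

lemma cscale_tensor: "cscale w (tensor v z) = tensor v (w * z)"
  by (simp add: complexification_simps algebra_simps)

lemma linear_tensor_left: "linear (\<lambda>v. tensor v z)"
  by (rule linearI) (simp_all add: complexification_simps algebra_simps)

lemma linear_tensor_right: "linear (tensor v)"
  by (rule linearI) (simp_all add: complexification_simps algebra_simps)

lemma tensor_universal:
  fixes f :: "'a::real_vector \<Rightarrow> complex \<Rightarrow> 'w::real_vector"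
  assumes left: "\<And>z. linear (\<lambda>v. f v z)" and right: "\<And>v. linear (f v)"
  shows "\<exists>!g. linear g \<and> (\<forall>v z. g (tensor v z) = f v z)"
proof (rule ex1I)
  let ?g = "\<lambda>x. f (re_part x) 1 + f (im_part x) \<i>"
  have "linear ?g"
    by (rule linearI)
      (simp_all add: complexification_simps linear_add[OF left] linear_cmul[OF left] algebra_simps)
  moreover have "?g (tensor v z) = f v z" for v z
  proof -
    have "f v z = f v (Re z *\<^sub>R 1 + Im z *\<^sub>R \<i>)"
      by (rule arg_cong[of _ _ "f v"]) (simp add: complex_eq_iff)
    also have "\<dots> = Re z *\<^sub>R f v 1 + Im z *\<^sub>R f v \<i>"
      by (simp only: linear_add[OF right] linear_cmul[OF right])
    finally show ?thesis
      by (simp add: tensor_def linear_cmul[OF left])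
  qed
  ultimately show "linear ?g \<and> (\<forall>v z. ?g (tensor v z) = f v z)" by blast
next
  fix g assume g: "linear g \<and> (\<forall>v z. g (tensor v z) = f v z)"
  show "g = (\<lambda>x. f (re_part x) 1 + f (im_part x) \<i>)"
  proof
    fix x :: "'a complexification"
    have "x = tensor (re_part x) 1 + tensor (im_part x) \<i>"
      by (simp add: complexification_simps)
    then have "g x = g (tensor (re_part x) 1) + g (tensor (im_part x) \<i>)"
      using g linear_add by metis
    then show "g x = f (re_part x) 1 + f (im_part x) \<i>" using g by simp
  qed
qed

text \<open>
  In the following, \<open>lam\<close> and \<open>h\<close> are the families of functionals and vectors; only their values
  at the indices \<open>1, \<dots>, m\<close> are meaningful.
\<close>

definition support_graph_edges ::
    "nat \<Rightarrow> (nat \<Rightarrow> 'b \<Rightarrow> real) \<Rightarrow> (nat \<Rightarrow> 'b) \<Rightarrow> nat set set" where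
  "support_graph_edges m lam h =
     {{i, j} | i j. i \<in> {1..m} \<and> j \<in> {1..m} \<and> i < j \<and> (lam j (h i) \<noteq> 0 \<or> lam i (h j) \<noteq> 0)}"

definition hhat :: "(nat \<Rightarrow> 'b::real_vector \<Rightarrow> real) \<Rightarrow> (nat \<Rightarrow> 'b) \<Rightarrow> nat \<Rightarrow> 'b" where
  "hhat lam h l = h l /\<^sub>R lam l (h l)"

definition signs :: "real set" where
  "signs = {1, -1}"

definition signed_coeff ::
    "(nat \<Rightarrow> 'b::real_vector \<Rightarrow> real) \<Rightarrow> (nat \<Rightarrow> 'b) \<Rightarrow> nat \<Rightarrow> nat \<Rightarrow> real \<Rightarrow> real
      \<Rightarrow> 'b complexification" where
  "signed_coeff lam h i j \<epsilon> \<delta> =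
     cscale (2 * \<i>) (tensor ((\<delta> * lam j (h i)) *\<^sub>R h j - (\<epsilon> * lam i (h j)) *\<^sub>R h i) 1)"

end

theory Submission
  imports Defs
begin

text \<open>
  Up to the invertible factor \<open>2 \<i>\<close>, the coefficient indexed by \<open>(\<epsilon>, \<delta>)\<close> is the real vector
  \<open>\<delta> \<lambda>\<^sub>j(h\<^sub>i) h\<^sub>j - \<epsilon> \<lambda>\<^sub>i(h\<^sub>j) h\<^sub>i\<close>, so its vanishing is a linear relation between \<open>h\<^sub>i\<close> and \<open>h\<^sub>j\<close>.
  Evaluating this relation at \<open>\<lambda>\<^sub>i\<close> and \<open>\<lambda>\<^sub>j\<close> shows that on an edge neither cross value can vanish
  and that \<open>\<lambda>\<^sub>j(h\<^sub>i) = (\<epsilon>/\<delta>) \<lambda>\<^sub>i(h\<^sub>i)\<close> and \<open>\<lambda>\<^sub>i(h\<^sub>j) = (\<delta>/\<epsilon>) \<lambda>\<^sub>j(h\<^sub>j)\<close>.  After substitution and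
  division by the diagonal values, the relation compares the normalised vectors.  Conversely,
  proportionality of the normalised vectors forces the same two cross values, because each
  normalised vector has value 1 under its own functional.

  The criterion depends on the signs only through \<open>\<delta>/\<epsilon>\<close>, which is unchanged when both signs are
  reversed.  It cannot hold for both ratios \<open>1\<close> and \<open>-1\<close>, as the normalised vectors are nonzero.
  So the vanishing coefficients on an edge, if any, form exactly one opposite pair.
\<close>

lemma signed_coeff_eq_0_iff:
  "signed_coeff lam h i j e d = 0 \<longleftrightarrow> (d * lam j (h i)) *\<^sub>R h j = (e * lam i (h j)) *\<^sub>R h i"
  by (simp add: signed_coeff_def complexification_simps)

lemma edge_iff:
  assumes "i \<in> {1..m}" "j \<in> {1..m}" "i < j"
  shows "{i, j} \<in> support_graph_edges m lam h \<longleftrightarrow> lam j (h i) \<noteq> 0 \<or> lam i (h j) \<noteq> 0"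
  using assms by (fastforce simp: support_graph_edges_def doubleton_eq_iff)

text \<open>
  The two evaluations determine the cross values \<open>g u\<close> and \<open>f v\<close> from either side of the
  equivalence.  Without the assumption that one of them is nonzero, the left-hand relation would be
  the trivial \<open>0 = 0\<close>.
\<close>

lemma cross_relation_iff_normalised_proportional:
  fixes f g :: "'b::real_vector \<Rightarrow> real"
  assumes f: "linear f" and g: "linear g"
    and fu: "f u \<noteq> 0" and gv: "g v \<noteq> 0"
    and d: "d \<noteq> 0" and e: "e \<noteq> 0"
    and cross: "g u \<noteq> 0 \<or> f v \<noteq> 0"
  shows "(d * g u) *\<^sub>R v = (e * f v) *\<^sub>R u \<longleftrightarrow> v /\<^sub>R g v = (d / e) *\<^sub>R (u /\<^sub>R f u)"
    (is "?L \<longleftrightarrow> ?R")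
proof -
  have R_iff: "?R \<longleftrightarrow> (e * f u) *\<^sub>R v = (d * g v) *\<^sub>R u"
  proof -
    let ?c = "e * f u * g v"
    have "?c *\<^sub>R (v /\<^sub>R g v) = (e * f u) *\<^sub>R v" "?c *\<^sub>R ((d / e) *\<^sub>R (u /\<^sub>R f u)) = (d * g v) *\<^sub>R u"
      using fu gv e by simp_all
    moreover have "?c \<noteq> 0"
      using fu gv e by simp
    ultimately show ?thesis
      by (metis scaleR_left_imp_eq)
  qed
  have cross_values: "f v = (d / e) * g v \<and> g u = (e / d) * f u" if "?L \<or> ?R"
    using that
  proof
    assume L: ?L
    have atf: "d * g u * f v = e * f v * f u"
      using arg_cong[OF L, of f] by (simp add: linear_cmul[OF f])
    have atg: "d * g u * g v = e * f v * g u"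
      using arg_cong[OF L, of g] by (simp add: linear_cmul[OF g])
    \<comment> \<open>A vanishing cross value would, by the evaluation at the other functional, make both vanish.\<close>
    have "g u \<noteq> 0" "f v \<noteq> 0"
      using atf atg cross fu gv d e by auto
    moreover have "d * g u * f v = e * f u * f v" "d * g v * g u = e * f v * g u"
      using atf atg by (simp_all only: mult_ac)
    ultimately have "d * g u = e * f u \<and> d * g v = e * f v"
      by (metis mult_right_cancel)
    then show ?thesis
      using d e by (simp add: field_simps)
  next
    assume ?R
    then have R: "(e * f u) *\<^sub>R v = (d * g v) *\<^sub>R u"
      by (simp only: R_iff)
    have "e * f u * f v = d * g v * f u"
      using arg_cong[OF R, of f] by (simp add: linear_cmul[OF f])
    moreover have "e * f u * g v = d * g v * g u"
      using arg_cong[OF R, of g] by (simp add: linear_cmul[OF g])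
    ultimately show ?thesis
      using fu gv d e by (simp add: field_simps)
  qed
  show ?thesis
  proof (cases "?L \<or> ?R")
    case True
    then have "d * g u = e * f u" "e * f v = d * g v"
      using cross_values d e by simp_all
    then show ?thesis
      by (simp only: R_iff)
  qed blast
qed

text \<open>
  On signs the ratio \<open>d / e\<close> only takes the values \<open>1\<close> and \<open>-1\<close>, each on one opposite pair of
  indices; a nonzero \<open>x\<close> excludes that both ratios solve \<open>y = r x\<close>.
\<close>

lemma sign_ratio_solutions:
  fixes x y :: "'b::real_vector"
  assumes "x \<noteq> 0"
  shows "(\<forall>e\<in>signs. \<forall>d\<in>signs. y \<noteq> (d / e) *\<^sub>R x) \<or>
    (\<exists>e\<in>signs. \<exists>d\<in>signs.
      {(e', d') \<in> signs \<times> signs. y = (d' / e') *\<^sub>R x} = {(e, d), (- e, - d)})"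
proof -
  have "x \<noteq> - x"
  proof
    assume "x = - x"
    then have "2 *\<^sub>R x = 0"
      by (metis add.right_inverse scaleR_2)
    with assms show False
      by simp
  qed
  consider "y = x" | "y = - x" | "y \<noteq> x" "y \<noteq> - x"
    by blast
  then show ?thesis
  proof cases
    case 1
    then have "{(e', d') \<in> signs \<times> signs. y = (d' / e') *\<^sub>R x} = {(1, 1), (- 1, - 1)}"
      using \<open>x \<noteq> - x\<close> by (auto simp: signs_def)
    then show ?thesis
      by (auto simp: signs_def)
  next
    case 2
    then have "{(e', d') \<in> signs \<times> signs. y = (d' / e') *\<^sub>R x} = {(1, - 1), (- 1, - (- 1))}"
      using \<open>x \<noteq> - x\<close> by (auto simp: signs_def)
    then show ?thesis
      unfolding signs_def by blast
  next
    case 3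
    then show ?thesis
      by (simp add: signs_def)
  qed
qed

theorem lemma4p1:
  fixes lam :: "nat \<Rightarrow> 'b::real_vector \<Rightarrow> real" and h :: "nat \<Rightarrow> 'b" and m :: nat
  assumes fin_dim: "\<exists>B :: 'b set. finite B \<and> span B = UNIV"
    and functional: "\<forall>l\<in>{1..m}. linear (lam l)"
    and nonzero: "\<forall>l\<in>{1..m}. lam l \<noteq> (\<lambda>_. 0)"
    and positive: "\<forall>l\<in>{1..m}. lam l (h l) > 0"
  shows "\<forall>i\<in>{1..m}. \<forall>j\<in>{1..m}. i < j \<longrightarrow>
      ({i, j} \<in> support_graph_edges m lam h \<longrightarrow>
         (\<forall>\<epsilon>\<in>signs. \<forall>\<delta>\<in>signs.
            signed_coeff lam h i j \<epsilon> \<delta> = 0 \<longleftrightarrow> hhat lam h j = (\<delta> / \<epsilon>) *\<^sub>R hhat lam h i)) \<and>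
      ({i, j} \<in> support_graph_edges m lam h \<longrightarrow>
         (\<forall>\<epsilon>\<in>signs. \<forall>\<delta>\<in>signs. signed_coeff lam h i j \<epsilon> \<delta> \<noteq> 0) \<or>
         (\<exists>\<epsilon>\<in>signs. \<exists>\<delta>\<in>signs.
            {(\<epsilon>', \<delta>') \<in> signs \<times> signs. signed_coeff lam h i j \<epsilon>' \<delta>' = 0}
              = {(\<epsilon>, \<delta>), (-\<epsilon>, -\<delta>)})) \<and>
      ({i, j} \<notin> support_graph_edges m lam h \<longrightarrow>
         (\<forall>\<epsilon>\<in>signs. \<forall>\<delta>\<in>signs. signed_coeff lam h i j \<epsilon> \<delta> = 0))"
proof (intro ballI impI)
  fix i j
  assume i: "i \<in> {1..m}" and j: "j \<in> {1..m}" and ij: "i < j"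
  have lin: "linear (lam i)" "linear (lam j)"
    using functional i j by auto
  have diag: "lam i (h i) > 0" "lam j (h j) > 0"
    using positive i j by auto
  have criterion: "signed_coeff lam h i j e d = 0 \<longleftrightarrow> hhat lam h j = (d / e) *\<^sub>R hhat lam h i"
    if "{i, j} \<in> support_graph_edges m lam h" "e \<in> signs" "d \<in> signs" for e d
  proof -
    have "e \<noteq> 0" "d \<noteq> 0"
      using that by (auto simp: signs_def)
    moreover have "lam j (h i) \<noteq> 0 \<or> lam i (h j) \<noteq> 0"
      using that edge_iff[OF i j ij] by blast
    ultimately show ?thesis
      unfolding signed_coeff_eq_0_iff hhat_def
      using diag by (intro cross_relation_iff_normalised_proportional lin) auto
  qed
  have "h i \<noteq> 0"
    using diag linear_0[OF lin(1)] by auto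
  then have "hhat lam h i \<noteq> 0"
    using diag by (simp add: hhat_def)
  note ratios = sign_ratio_solutions[OF this, of "hhat lam h j"]
  have dichotomy: "(\<forall>e\<in>signs. \<forall>d\<in>signs. signed_coeff lam h i j e d \<noteq> 0) \<or>
      (\<exists>e\<in>signs. \<exists>d\<in>signs.
        {(e', d') \<in> signs \<times> signs. signed_coeff lam h i j e' d' = 0} = {(e, d), (- e, - d)})"
    if edge: "{i, j} \<in> support_graph_edges m lam h"
  proof -
    have "{(e', d') \<in> signs \<times> signs. signed_coeff lam h i j e' d' = 0} =
        {(e', d') \<in> signs \<times> signs. hhat lam h j = (d' / e') *\<^sub>R hhat lam h i}"
      using criterion[OF edge] by auto
    then show ?thesis
      using ratios criterion[OF edge] by simp
  qed
  have "signed_coeff lam h i j e d = 0" if "{i, j} \<notin> support_graph_edges m lam h" for e d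
    using that by (simp add: signed_coeff_eq_0_iff edge_iff[OF i j ij])
  with criterion dichotomy show "({i, j} \<in> support_graph_edges m lam h \<longrightarrow>
         (\<forall>\<epsilon>\<in>signs. \<forall>\<delta>\<in>signs.
            signed_coeff lam h i j \<epsilon> \<delta> = 0 \<longleftrightarrow> hhat lam h j = (\<delta> / \<epsilon>) *\<^sub>R hhat lam h i)) \<and>
      ({i, j} \<in> support_graph_edges m lam h \<longrightarrow>
         (\<forall>\<epsilon>\<in>signs. \<forall>\<delta>\<in>signs. signed_coeff lam h i j \<epsilon> \<delta> \<noteq> 0) \<or>
         (\<exists>\<epsilon>\<in>signs. \<exists>\<delta>\<in>signs.
            {(\<epsilon>', \<delta>') \<in> signs \<times> signs. signed_coeff lam h i j \<epsilon>' \<delta>' = 0}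
              = {(\<epsilon>, \<delta>), (-\<epsilon>, -\<delta>)})) \<and>
      ({i, j} \<notin> support_graph_edges m lam h \<longrightarrow>
         (\<forall>\<epsilon>\<in>signs. \<forall>\<delta>\<in>signs. signed_coeff lam h i j \<epsilon> \<delta> = 0))"
    by blast
qed

end
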